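(* Let $n\in\mathcal{N}$, let nonzero beamformers $\mathbf{w}_j\in\mathbb{C}^L$ ($j\in\mathcal{N}$), constants $\lambda_j>0$, $t_j>0$ ($j\in\mathcal{N}$), $\mu_j\ge0$ ($j\in\mathcal{N}$, $j\neq n$), and a reference power vector $\bar{\mathbf{p}}$ with positive entries be given, and let $M_n$ be the corresponding constant defined in the context. Consider the problem in the single real variable $p_n^{\mathrm{u}}$ (all other powers $p_i^{\mathrm{u}}=\bar p_i$, $i\ne n$, being fixed) $$\min_{p_n^{\mathrm{u}}}\ (\lambda_n+M_n)p_n^{\mathrm{u}}-\lambda_nt_nR_n^{\mathrm{a}}(\mathbf{p}^{\mathrm{u}},\mathbf{w}_n)\quad\text{s.t.}\quad\widetilde{\mathrm{C}}2:\ \gamma_n^{\mathrm{a}}(\mathbf{p}^{\mathrm{u}},\mathbf{w}_n)\ge\tau_n,\quad\widetilde{\mathrm{C}}3:\ 0\le p_n^{\mathrm{u}}\le P_{\max}^{\mathrm{u}},$$ and assume it is feasible. Define $$\Lambda_n=\frac{|\mathbf{w}_n^H\mathbf{h}_{n,n}^{\mathrm{a}}|^2}{\sum_{i=1,i\ne n}^Np_i^{\mathrm{u}}|\mathbf{w}_n^H\mathbf{h}_{i,n}^{\mathrm{a}}|^2+\sigma_n^2\|\mathbf{w}_n\|^2},\qquad G_n=\frac{B^{\mathrm{a}}}{\ln2}\,\frac{\lambda_nt_n}{\lambda_n+M_n}-\frac1{\Lambda_n}.$$ Then the solution of the problem is $$p_n^{\mathrm{u}*}=\begin{cases}\dfrac{\tau_n}{\Lambda_n},&\text{if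 }G_n<\dfrac{\tau_n}{\Lambda_n},\\[2mm] G_n,&\text{if }\dfrac{\tau_n}{\Lambda_n}\le G_n\le P_{\max}^{\mathrm{u}},\\[2mm] P_{\max}^{\mathrm{u}},&\text{if }G_n>P_{\max}^{\mathrm{u}},\end{cases}$$ and optimal Lagrange multipliers $\mu_n^*$ and $\nu_n^*$ associated with $\widetilde{\mathrm{C}}2$ and with the upper bound in $\widetilde{\mathrm{C}}3$, respectively, are $$\mu_n^*=\begin{cases}\dfrac{\lambda_n+M_n}{\Lambda_n}-\dfrac{B^{\mathrm{a}}}{\ln2}\dfrac{\lambda_nt_n}{\tau_n+1},&\text{if }G_n<\dfrac{\tau_n}{\Lambda_n},\\[2mm]0,&\text{otherwise,}\end{cases}\qquad \nu_n^*=\begin{cases}0,&\text{if }G_n\le P_{\max}^{\mathrm{u}},\\[2mm]\dfrac{B^{\mathrm{a}}}{\ln2}\dfrac{\lambda_nt_n}{P_{\max}^{\mathrm{u}}+1/\Lambda_n}-\lambda_n-M_n,&\text{otherwise.}\end{cases}$$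
   Context: $\mathcal{N}=\{1,\dots,N\}$; $L\ge1$ is an integer. The constants $B^{\mathrm{a}},I_n,\sigma_n^2,P_{\max}^{\mathrm{u}},T_{\mathrm{th}},T_n^{\mathrm{edge}}$ are positive reals, $\widehat{c}_n\in[0,1]$ is fixed with $T_{\mathrm{th}}-\widehat{c}_nT_n^{\mathrm{edge}}>0$, and $$\tau_n=2^{\frac{I_n}{B^{\mathrm{a}}(T_{\mathrm{th}}-\widehat{c}_nT_n^{\mathrm{edge}})}}-1>0.$$ The channel vectors $\mathbf{h}_{i,n}^{\mathrm{a}}\in\mathbb{C}^{L}$ ($i,n\in\mathcal{N}$) are given, and $\mathbf{w}_j^H\mathbf{h}_{j,j}^{\mathrm{a}}\ne0$ for all $j$; $(\cdot)^H$ denotes conjugate transpose. For a power vector $\mathbf{p}^{\mathrm{u}}=(p_1^{\mathrm{u}},\dots,p_N^{\mathrm{u}})$, $$\gamma_j^{\mathrm{a}}(\mathbf{p}^{\mathrm{u}},\mathbf{w}_j)=\frac{p_j^{\mathrm{u}}|\mathbf{w}_j^H\mathbf{h}_{j,j}^{\mathrm{a}}|^2}{\sum_{i=1,i\ne j}^N p_i^{\mathrm{u}}|\mathbf{w}_j^H\mathbf{h}_{i,j}^{\mathrm{a}}|^2+\sigma_j^2\|\mathbf{w}_j\|^2},\qquad R_j^{\mathrm{a}}(\mathbf{p}^{\mathrm{u}},\mathbf{w}_j)=B^{\mathrm{a}}\log_2(1+\gamma_j^{\mathrm{a}}(\mathbf{p}^{\mathrm{u}},\mathbf{w}_j)).$$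 The constant $M_n$ (not depending on the optimization variable $p_n^{\mathrm{u}}$) is $$M_n=\sum_{j\ne n}\lambda_jt_j\frac{B^{\mathrm{a}}}{\ln 2}\,\frac{(\bar\gamma_j)^2|\mathbf{w}_j^H\mathbf{h}_{n,j}^{\mathrm{a}}|^2}{\bar p_j|\mathbf{w}_j^H\mathbf{h}_{j,j}^{\mathrm{a}}|^2(1+\bar\gamma_j)}+\sum_{j\ne n}\mu_j\frac{(\bar\gamma_j)^2|\mathbf{w}_j^H\mathbf{h}_{n,j}^{\mathrm{a}}|^2}{\bar p_j|\mathbf{w}_j^H\mathbf{h}_{j,j}^{\mathrm{a}}|^2},\qquad \bar\gamma_j=\gamma_j^{\mathrm{a}}(\bar{\mathbf{p}},\mathbf{w}_j).$$ "Optimal Lagrange multipliers" means that $(p_n^{\mathrm{u}*},\mu_n^*,\nu_n^* )$ satisfies the Karush-Kuhn-Tucker conditions of the problem (stationarity, primal feasibility, nonnegative multipliers, complementary slackness) with the constraints written as $\tau_n-\gamma_n^{\mathrm{a}}\le0$ (multiplier $\mu_n$) and $p_n^{\mathrm{u}}-P_{\max}^{\mathrm{u}}\le0$ (multiplier $\nu_n$), the constraint $p_n^{\mathrm{u}}\ge0$ having multiplier $0$. *)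

theory Defs
  imports "HOL-Analysis.Analysis"
begin

definition herm_dot :: "complex ^ 'l \<Rightarrow> complex ^ 'l \<Rightarrow> complex" where
  "herm_dot w h = (\<Sum>k\<in>UNIV. cnj (w $ k) * h $ k)"

text \<open>
  Users are numbered \<open>1..N\<close>; \<open>h i j\<close> is the channel vector from user \<open>i\<close> seen with the
  beamformer \<open>w\<close> of user \<open>j\<close>, \<open>\<sigma>2 j\<close> is the noise power (already squared), and \<open>p\<close> is
  the power vector, of which only the entries in \<open>{1..N}\<close> matter.
\<close>

definition interf_noise ::
  "nat \<Rightarrow> (nat \<Rightarrow> nat \<Rightarrow> complex ^ 'l) \<Rightarrow> (nat \<Rightarrow> real) \<Rightarrow> (nat \<Rightarrow> real) \<Rightarrow> complex ^ 'l \<Rightarrow> nat \<Rightarrow> real"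
  where
  "interf_noise N h \<sigma>2 p w j =
     (\<Sum>i\<in>{1..N} - {j}. p i * (cmod (herm_dot w (h i j)))\<^sup>2) + \<sigma>2 j * (norm w)\<^sup>2"

definition sinr ::
  "nat \<Rightarrow> (nat \<Rightarrow> nat \<Rightarrow> complex ^ 'l) \<Rightarrow> (nat \<Rightarrow> real) \<Rightarrow> (nat \<Rightarrow> real) \<Rightarrow> complex ^ 'l \<Rightarrow> nat \<Rightarrow> real"
  where
  "sinr N h \<sigma>2 p w j = p j * (cmod (herm_dot w (h j j)))\<^sup>2 / interf_noise N h \<sigma>2 p w j"

definition rate ::
  "real \<Rightarrow> nat \<Rightarrow> (nat \<Rightarrow> nat \<Rightarrow> complex ^ 'l) \<Rightarrow> (nat \<Rightarrow> real) \<Rightarrow> (nat \<Rightarrow> real) \<Rightarrow> complex ^ 'l \<Rightarrow> nat \<Rightarrow> real"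
  where
  "rate B N h \<sigma>2 p w j = B * log 2 (1 + sinr N h \<sigma>2 p w j)"

definition sinr_threshold :: "real \<Rightarrow> real \<Rightarrow> real \<Rightarrow> real \<Rightarrow> real \<Rightarrow> real" where
  "sinr_threshold B I Tth c Tedge = 2 powr (I / (B * (Tth - c * Tedge))) - 1"

text \<open>
  The marginal interference cost that user \<open>n\<close> imposes on the others: minus the derivative at
  \<open>pbar\<close>, with respect to the power of user \<open>n\<close>, of the sum over \<open>j \<noteq> n\<close> of
  \<open>lam j * t j\<close> times the rate plus \<open>mu j\<close> times the SINR of user \<open>j\<close>.
\<close>

definition interf_price ::
  "real \<Rightarrow> nat \<Rightarrow> (nat \<Rightarrow> nat \<Rightarrow> complex ^ 'l) \<Rightarrow> (nat \<Rightarrow> real) \<Rightarrow> (nat \<Rightarrow> real) \<Rightarrow> (nat \<Rightarrow> complex ^ 'l)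
     \<Rightarrow> (nat \<Rightarrow> real) \<Rightarrow> (nat \<Rightarrow> real) \<Rightarrow> (nat \<Rightarrow> real) \<Rightarrow> nat \<Rightarrow> real"
  where
  "interf_price B N h \<sigma>2 pbar w lam t mu n =
     (let \<gamma> = (\<lambda>j. sinr N h \<sigma>2 pbar (w j) j) in
        (\<Sum>j\<in>{1..N} - {n}. lam j * t j * (B / ln 2) *
            ((\<gamma> j)\<^sup>2 * (cmod (herm_dot (w j) (h n j)))\<^sup>2 /
             (pbar j * (cmod (herm_dot (w j) (h j j)))\<^sup>2 * (1 + \<gamma> j))))
      + (\<Sum>j\<in>{1..N} - {n}. mu j *
            ((\<gamma> j)\<^sup>2 * (cmod (herm_dot (w j) (h n j)))\<^sup>2 /
             (pbar j * (cmod (herm_dot (w j) (h j j)))\<^sup>2))))"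

text \<open>
  KKT conditions at \<open>x\<close> for minimizing \<open>f\<close> over the reals subject to \<open>g x \<le> 0\<close> for all
  pairs \<open>(g, m)\<close> in the list, \<open>m\<close> being the multiplier of the constraint \<open>g\<close>.
\<close>

definition kkt_point :: "(real \<Rightarrow> real) \<Rightarrow> ((real \<Rightarrow> real) \<times> real) list \<Rightarrow> real \<Rightarrow> bool" where
  "kkt_point f cs x \<longleftrightarrow>
     f differentiable at x \<and> (\<forall>(g, m)\<in>set cs. g differentiable at x) \<and>
     deriv f x + (\<Sum>(g, m)\<leftarrow>cs. m * deriv g x) = 0 \<and>
     (\<forall>(g, m)\<in>set cs. g x \<le> 0) \<and>
     (\<forall>(g, m)\<in>set cs. 0 \<le> m) \<and>
     (\<forall>(g, m)\<in>set cs. m * g x = 0)"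

end

theory Submission
  imports Defs
begin

text \<open>
  As functions of the power of user \<open>n\<close> alone, the SINR is linear with slope \<open>\<Lambda>\<close> and the objective
  is \<open>A x - K ln (1 + \<Lambda> x)\<close> with \<open>A, K > 0\<close>, which lies strictly above its tangents. Summing the
  tangent inequalities with the multipliers as weights shows that a KKT point is the unique
  minimizer, so everything follows from checking the KKT conditions of the claimed solution.
\<close>

text \<open>Weak duality along the segment from \<open>x\<close> to one competitor \<open>y\<close>.
  The tangent inequalities are assumed at this \<open>y\<close> only, so an objective that is convex
  merely on part of the line qualifies. Strictness comes from \<open>f\<close> alone; affine
  constraints are allowed.\<close>

lemma kkt_point_strict_minimum:
  assumes kkt: "kkt_point f cs x"
    and above_tangent: "f x + deriv f x * (y - x) < f y"
    and constraints_above_tangent: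
      "\<And>g m. (g, m) \<in> set cs \<Longrightarrow> g x + deriv g x * (y - x) \<le> g y"
    and feasible: "\<And>g m. (g, m) \<in> set cs \<Longrightarrow> g y \<le> 0"
  shows "f x < f y"
proof -
  have "m * deriv g x * (y - x) \<le> 0" if gm: "(g, m) \<in> set cs" for g m
  proof -
    have m: "0 \<le> m" "m * g x = 0"
      using kkt gm by (auto simp: kkt_point_def)
    \<comment> \<open>Complementary slackness removes \<open>m * g x\<close>, which leaves only the
      slope term.\<close>
    have "m * (g x + deriv g x * (y - x)) \<le> m * 0"
      using constraints_above_tangent[OF gm] feasible[OF gm] m(1)
      by (intro mult_left_mono) auto
    then show ?thesis
      using m(2) by (simp add: algebra_simps)
  qed
  then have "(\<Sum>(g, m)\<leftarrow>cs. m * deriv g x * (y - x)) \<le> 0"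
    by (intro sum_list_nonpos) auto
  also have "(\<Sum>(g, m)\<leftarrow>cs. m * deriv g x * (y - x)) = (\<Sum>(g, m)\<leftarrow>cs. m * deriv g x) * (y - x)"
    by (simp add: sum_list_mult_const[symmetric] case_prod_unfold)
  also have "(\<Sum>(g, m)\<leftarrow>cs. m * deriv g x) = - deriv f x"
    using kkt by (simp add: kkt_point_def)
  finally show ?thesis
    using above_tangent by simp
qed

lemma is_arg_min_unique:
  fixes f :: "'a \<Rightarrow> 'b::order"
  assumes "P x" and "\<And>y. P y \<Longrightarrow> y \<noteq> x \<Longrightarrow> f x < f y"
  shows "is_arg_min f P y \<longleftrightarrow> y = x"
  using assms unfolding is_arg_min_def by (metis less_asym)

text \<open>Strict concavity of \<open>ln\<close>: the bound \<open>ln r \<le> r - 1\<close> is an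
  equality only at \<open>r = 1\<close>, and it is applied to \<open>r = v / u\<close>.\<close>

lemma ln_less_tangent:
  fixes u v :: real
  assumes "0 < u" "0 < v" "u \<noteq> v"
  shows "ln v < ln u + (v - u) / u"
proof -
  have "ln (v / u) < v / u - 1"
    using assms ln_le_minus_one[of "v / u"] ln_eq_minus_one[of "v / u"]
    by (cases "v = u") (auto simp: less_le)
  then show ?thesis
    using assms by (simp add: ln_div diff_divide_distrib)
qed

lemma DERIV_linear_minus_log:
  fixes A K \<Lambda> x :: real
  assumes "0 < 1 + \<Lambda> * x"
  shows "((\<lambda>x. A * x - K * ln (1 + \<Lambda> * x)) has_real_derivative A - K * \<Lambda> / (1 + \<Lambda> * x)) (at x)"
  using assms by (auto intro!: derivative_eq_intros)

lemma linear_minus_log_above_tangent: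
  fixes A K \<Lambda> x y :: real
  assumes "0 < K" "0 < \<Lambda>" "0 < 1 + \<Lambda> * x" "0 < 1 + \<Lambda> * y" "x \<noteq> y"
  shows "A * x - K * ln (1 + \<Lambda> * x) + (A - K * \<Lambda> / (1 + \<Lambda> * x)) * (y - x)
    < A * y - K * ln (1 + \<Lambda> * y)"
proof -
  have "ln (1 + \<Lambda> * y) < ln (1 + \<Lambda> * x) + (1 + \<Lambda> * y - (1 + \<Lambda> * x)) / (1 + \<Lambda> * x)"
    using assms by (intro ln_less_tangent) auto
  also have "1 + \<Lambda> * y - (1 + \<Lambda> * x) = \<Lambda> * (y - x)"
    by (simp add: algebra_simps)
  finally have "K * ln (1 + \<Lambda> * y) < K * (ln (1 + \<Lambda> * x) + \<Lambda> * (y - x) / (1 + \<Lambda> * x))"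
    using assms(1) by (rule mult_strict_left_mono)
  then show ?thesis
    by (simp add: algebra_simps)
qed

text \<open>\<open>G\<close> is the zero of the derivative of \<open>f\<close>, that is, the water
  level \<open>K / A\<close> minus the ground level \<open>1 / \<Lambda>\<close>. As this derivative
  is increasing, the minimizer \<open>p\<close> is \<open>G\<close> clamped to the interval from
  \<open>\<tau> / \<Lambda>\<close> to \<open>P\<close>. The multipliers arise by solving the
  stationarity equation at the active endpoint.\<close>

lemma water_filling:
  fixes A K \<Lambda> \<tau> P :: real
  defines "f \<equiv> \<lambda>x. A * x - K * ln (1 + \<Lambda> * x)"
    and "G \<equiv> K / A - 1 / \<Lambda>"
  defines "p \<equiv> (if G < \<tau> / \<Lambda> then \<tau> / \<Lambda> else if G \<le> P then G else P)"
    and "\<mu> \<equiv> (if G < \<tau> / \<Lambda> then A / \<Lambda> - K / (\<tau> + 1) else 0)"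
    and "\<nu> \<equiv> (if G \<le> P then 0 else K / (P + 1 / \<Lambda>) - A)"
  assumes pos: "0 < A" "0 < K" "0 < \<Lambda>" "0 < \<tau>" "0 < P"
    and nonempty: "\<tau> / \<Lambda> \<le> P"
  shows "kkt_point f [(\<lambda>x. \<tau> - \<Lambda> * x, \<mu>), (\<lambda>x. x - P, \<nu>), (\<lambda>x. - x, 0)] p"
    and "is_arg_min f (\<lambda>x. \<tau> \<le> \<Lambda> * x \<and> 0 \<le> x \<and> x \<le> P) y \<longleftrightarrow> y = p"
proof -
  define cs where "cs = [(\<lambda>x. \<tau> - \<Lambda> * x, \<mu>), (\<lambda>x. x - P, \<nu>), (\<lambda>x. - x, 0)]"
  have p_bounds: "\<tau> / \<Lambda> \<le> p" "p \<le> P"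
    using nonempty by (auto simp: p_def)
  have "0 < \<tau> / \<Lambda>"
    using pos by simp
  then have p_pos: "0 < p"
    using p_bounds(1) by linarith
  have p_sinr: "\<tau> \<le> \<Lambda> * p"
    using p_bounds(1) pos by (simp add: field_simps)
  have u_pos: "0 < 1 + \<Lambda> * x" if "0 \<le> x" for x
    using pos that by (simp add: add_pos_nonneg)
  have f': "(f has_real_derivative A - K * \<Lambda> / (1 + \<Lambda> * p)) (at p)"
    unfolding f_def using u_pos p_pos by (intro DERIV_linear_minus_log) auto
  \<comment> \<open>The last constraint appears as \<open>uminus\<close>, the eta-contracted form of
    \<open>\<lambda>x. - x\<close>.\<close>
  have cs_derivs: "((\<lambda>x. \<tau> - \<Lambda> * x) has_real_derivative - \<Lambda>) (at p)"
    "((\<lambda>x. x - P) has_real_derivative 1) (at p)" "(uminus has_real_derivative - 1) (at p)"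
    by (auto intro!: derivative_eq_intros)
  note derivs = f'[THEN DERIV_imp_deriv] cs_derivs[THEN DERIV_imp_deriv]
  \<comment> \<open>This and the next fact turn the position of \<open>G\<close> relative to
    \<open>z\<close> into the sign of the derivative of \<open>f\<close> at
    \<open>z\<close>.\<close>
  have G_less_iff: "G < z \<longleftrightarrow> K * \<Lambda> / (1 + \<Lambda> * z) < A" if "0 \<le> z" for z
    using pos u_pos[OF that] by (simp add: G_def field_simps)
  have less_G_iff: "z < G \<longleftrightarrow> A < K * \<Lambda> / (1 + \<Lambda> * z)" if "0 \<le> z" for z
    using pos u_pos[OF that] by (simp add: G_def field_simps)
  \<comment> \<open>In the nontrivial case \<open>\<mu> * \<Lambda>\<close> is the derivative of
    \<open>f\<close> at \<open>\<tau> / \<Lambda>\<close>; in the next fact \<open>\<nu>\<close> is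
    minus the derivative at \<open>P\<close>.\<close>
  have \<mu>_nonneg: "0 \<le> \<mu>"
    using G_less_iff[of "\<tau> / \<Lambda>"] pos by (auto simp: \<mu>_def field_simps)
  have \<nu>_nonneg: "0 \<le> \<nu>"
    using less_G_iff[of P] pos u_pos[of P] by (auto simp: \<nu>_def field_simps)
  have stationary: "A - K * \<Lambda> / (1 + \<Lambda> * p) - \<mu> * \<Lambda> + \<nu> = 0"
  proof (cases "G < \<tau> / \<Lambda>")
    case True
    \<comment> \<open>Nonemptiness gives \<open>G < \<tau> / \<Lambda> \<le> P\<close>, so the two
      multipliers are never both active.\<close>
    then have "p = \<tau> / \<Lambda>" "\<mu> = A / \<Lambda> - K / (\<tau> + 1)" "\<nu> = 0"
      using nonempty by (auto simp: p_def \<mu>_def \<nu>_def)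
    then have "\<Lambda> * p = \<tau>" "\<mu> * \<Lambda> = A - K * \<Lambda> / (1 + \<tau>)"
      using pos by (simp_all add: left_diff_distrib add.commute)
    then show ?thesis
      using \<open>\<nu> = 0\<close> by simp
  next
    case not_less: False
    then have \<mu>_0: "\<mu> = 0"
      by (simp add: \<mu>_def)
    show ?thesis
    proof (cases "G \<le> P")
      case True
      then have "p = G" "\<nu> = 0"
        using not_less by (auto simp: p_def \<nu>_def)
      \<comment> \<open>By the choice of \<open>G\<close>,
        \<open>1 + \<Lambda> * G = K * \<Lambda> / A\<close>.\<close>
      moreover have "K * \<Lambda> / (1 + \<Lambda> * G) = A"
        using pos by (simp add: G_def field_simps)
      ultimately show ?thesis
        using \<mu>_0 by simp
    next
      case False
      then have "p = P" "\<nu> = K / (P + 1 / \<Lambda>) - A"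
        using not_less by (auto simp: p_def \<nu>_def)
      moreover have "K / (P + 1 / \<Lambda>) = K * \<Lambda> / (1 + \<Lambda> * P)"
        using pos u_pos[of P] by (simp add: field_simps)
      ultimately show ?thesis
        using \<mu>_0 by simp
    qed
  qed
  have slack: "\<mu> * (\<tau> - \<Lambda> * p) = 0" "\<nu> * (p - P) = 0"
    using pos nonempty by (auto simp: p_def \<mu>_def \<nu>_def)
  have "deriv f p + (\<Sum>(g, m)\<leftarrow>cs. m * deriv g p) = 0"
    using stationary by (simp add: cs_def derivs)
  moreover have "f differentiable at p" "\<forall>(g, m)\<in>set cs. g differentiable at p"
    using f' cs_derivs unfolding cs_def by (auto simp: real_differentiable_def)
  ultimately have kkt: "kkt_point f cs p"
    using slack p_sinr p_bounds p_pos \<mu>_nonneg \<nu>_nonneg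
    unfolding kkt_point_def by (simp add: cs_def)
  then show "kkt_point f [(\<lambda>x. \<tau> - \<Lambda> * x, \<mu>), (\<lambda>x. x - P, \<nu>), (\<lambda>x. - x, 0)] p"
    by (simp add: cs_def)
  show "is_arg_min f (\<lambda>x. \<tau> \<le> \<Lambda> * x \<and> 0 \<le> x \<and> x \<le> P) y \<longleftrightarrow> y = p"
  proof (rule is_arg_min_unique)
    fix z assume z: "\<tau> \<le> \<Lambda> * z \<and> 0 \<le> z \<and> z \<le> P" "z \<noteq> p"
    show "f p < f z"
    proof (rule kkt_point_strict_minimum[OF kkt])
      show "f p + deriv f p * (z - p) < f z"
        \<comment> \<open>The derivative facts mention \<open>f\<close> folded, so they must be
          applied before \<open>f_def\<close>.\<close>
        unfolding derivs unfolding f_def using pos u_pos z p_pos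
        by (intro linear_minus_log_above_tangent) auto
      \<comment> \<open>The constraints are affine and hence coincide with their tangents.\<close>
      show "g p + deriv g p * (z - p) \<le> g z" if "(g, m) \<in> set cs" for g m
        using that by (auto simp: cs_def derivs right_diff_distrib)
      show "g z \<le> 0" if "(g, m) \<in> set cs" for g m
        using that z by (auto simp: cs_def)
    qed
  qed (use p_bounds p_pos p_sinr in auto)
qed

text \<open>The interference sum skips the index \<open>j\<close>. This is what makes the SINR of a
  user linear in that user's own power.\<close>

lemma interf_noise_update_own [simp]:
  "interf_noise N h \<sigma>2 (p(j := x)) w j = interf_noise N h \<sigma>2 p w j"
  by (simp add: interf_noise_def)

lemma interf_noise_pos:
  assumes "\<And>i. i \<in> {1..N} \<Longrightarrow> 0 \<le> p i" and "0 < \<sigma>2 j" and "w \<noteq> 0"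
  shows "0 < interf_noise N h \<sigma>2 p w j"
  unfolding interf_noise_def using assms by (intro add_nonneg_pos sum_nonneg) auto

lemma sinr_nonneg:
  assumes "0 \<le> p j" and "0 \<le> interf_noise N h \<sigma>2 p w j"
  shows "0 \<le> sinr N h \<sigma>2 p w j"
  using assms by (simp add: sinr_def)

text \<open>Every summand is nonnegative. This serves to make the linear coefficient
  \<open>lam n + M\<close> of the objective positive.\<close>

lemma interf_price_nonneg:
  assumes "0 \<le> B"
    and "\<And>j. j \<in> {1..N} - {n} \<Longrightarrow> 0 \<le> lam j \<and> 0 \<le> t j \<and> 0 \<le> mu j \<and> 0 \<le> p j"
    and "\<And>j. j \<in> {1..N} - {n} \<Longrightarrow> 0 \<le> sinr N h \<sigma>2 p (w j) j"
  shows "0 \<le> interf_price B N h \<sigma>2 p w lam t mu n"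
  unfolding interf_price_def Let_def
proof (intro add_nonneg_nonneg sum_nonneg)
  fix j assume j: "j \<in> {1..N} - {n}"
  have "0 \<le> lam j" "0 \<le> t j" "0 \<le> mu j" "0 \<le> p j" "0 \<le> sinr N h \<sigma>2 p (w j) j"
    using assms j by blast+
  then show "0 \<le> lam j * t j * (B / ln 2) *
      ((sinr N h \<sigma>2 p (w j) j)\<^sup>2 * (cmod (herm_dot (w j) (h n j)))\<^sup>2 /
        (p j * (cmod (herm_dot (w j) (h j j)))\<^sup>2 * (1 + sinr N h \<sigma>2 p (w j) j)))"
    and "0 \<le> mu j *
      ((sinr N h \<sigma>2 p (w j) j)\<^sup>2 * (cmod (herm_dot (w j) (h n j)))\<^sup>2 /
        (p j * (cmod (herm_dot (w j) (h j j)))\<^sup>2))"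
    using \<open>0 \<le> B\<close> by simp_all
qed

lemma sinr_threshold_pos:
  assumes "0 < B" "0 < I" "0 < Tth - c * Tedge"
  shows "0 < sinr_threshold B I Tth c Tedge"
  using assms by (simp add: sinr_threshold_def)

theorem theorem1:
  fixes N n :: nat
    and B Pmax Tth :: real
    and I \<sigma>2 Tedge c lam t mu pbar :: "nat \<Rightarrow> real"
    and h :: "nat \<Rightarrow> nat \<Rightarrow> complex ^ 'l"
    and w :: "nat \<Rightarrow> complex ^ 'l"
  defines "\<tau> \<equiv> sinr_threshold B (I n) Tth (c n) (Tedge n)"
    and "M \<equiv> interf_price B N h \<sigma>2 pbar w lam t mu n"
    and "\<gamma> \<equiv> (\<lambda>x. sinr N h \<sigma>2 (pbar(n := x)) (w n) n)"
  defines "obj \<equiv> (\<lambda>x. (lam n + M) * x - lam n * t n * rate B N h \<sigma>2 (pbar(n := x)) (w n) n)"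
    and "feasible \<equiv> (\<lambda>x. \<gamma> x \<ge> \<tau> \<and> 0 \<le> x \<and> x \<le> Pmax)"
    and "\<Lambda> \<equiv> (cmod (herm_dot (w n) (h n n)))\<^sup>2 / interf_noise N h \<sigma>2 pbar (w n) n"
  defines "G \<equiv> (B / ln 2) * (lam n * t n / (lam n + M)) - 1 / \<Lambda>"
  defines "p_opt \<equiv> (if G < \<tau> / \<Lambda> then \<tau> / \<Lambda> else if G \<le> Pmax then G else Pmax)"
    and "mu_opt \<equiv> (if G < \<tau> / \<Lambda>
                   then (lam n + M) / \<Lambda> - (B / ln 2) * (lam n * t n / (\<tau> + 1)) else 0)"
    and "nu_opt \<equiv> (if G \<le> Pmax
                   then 0 else (B / ln 2) * (lam n * t n / (Pmax + 1 / \<Lambda>)) - lam n - M)"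
  assumes n: "n \<in> {1..N}"
    and consts_pos: "B > 0" "Pmax > 0" "Tth > 0"
    and user_consts_pos: "\<And>i. i \<in> {1..N} \<Longrightarrow> I i > 0 \<and> \<sigma>2 i > 0 \<and> Tedge i > 0"
    and c: "\<And>i. i \<in> {1..N} \<Longrightarrow> 0 \<le> c i \<and> c i \<le> 1 \<and> Tth - c i * Tedge i > 0"
    and w_nonzero: "\<And>j. j \<in> {1..N} \<Longrightarrow> w j \<noteq> 0"
    and channel_nonzero: "\<And>j. j \<in> {1..N} \<Longrightarrow> herm_dot (w j) (h j j) \<noteq> 0"
    and lam_t_pos: "\<And>j. j \<in> {1..N} \<Longrightarrow> lam j > 0 \<and> t j > 0"
    and mu_nonneg: "\<And>j. j \<in> {1..N} \<Longrightarrow> j \<noteq> n \<Longrightarrow> mu j \<ge> 0"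
    and pbar_pos: "\<And>i. i \<in> {1..N} \<Longrightarrow> pbar i > 0"
    and feasible: "\<exists>x. feasible x"
  shows "(\<forall>x. is_arg_min obj feasible x \<longleftrightarrow> x = p_opt) \<and>
    kkt_point obj [(\<lambda>x. \<tau> - \<gamma> x, mu_opt), (\<lambda>x. x - Pmax, nu_opt), (\<lambda>x. - x, 0)] p_opt"
proof -
  \<comment> \<open>The factor \<open>1 / ln 2\<close> in \<open>K\<close> converts the binary
    logarithm of the rate into \<open>ln\<close>.\<close>
  define A K where "A = lam n + M" and "K = (B / ln 2) * (lam n * t n)"
  have noise_pos: "0 < interf_noise N h \<sigma>2 pbar (w j) j" if "j \<in> {1..N}" for j
    using that pbar_pos user_consts_pos w_nonzero by (intro interf_noise_pos) (auto intro: less_imp_le)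
  have "0 \<le> sinr N h \<sigma>2 pbar (w j) j" if "j \<in> {1..N}" for j
    using that pbar_pos noise_pos by (intro sinr_nonneg) (auto intro: less_imp_le)
  then have "0 \<le> M"
    unfolding M_def using consts_pos lam_t_pos mu_nonneg pbar_pos
    by (intro interf_price_nonneg) (auto intro: less_imp_le)
  then have A_pos: "0 < A"
    using lam_t_pos[OF n] by (simp add: A_def)
  have K_pos: "0 < K"
    using consts_pos lam_t_pos[OF n] by (simp add: K_def)
  have \<Lambda>_pos: "0 < \<Lambda>"
    using channel_nonzero[OF n] noise_pos[OF n] by (simp add: \<Lambda>_def)
  have \<tau>_pos: "0 < \<tau>"
    unfolding \<tau>_def using consts_pos user_consts_pos[OF n] c[OF n] by (intro sinr_threshold_pos) auto
  have \<gamma>: "\<gamma> = (\<lambda>x. \<Lambda> * x)"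
    by (simp add: \<gamma>_def sinr_def \<Lambda>_def mult.commute)
  have obj: "obj = (\<lambda>x. A * x - K * ln (1 + \<Lambda> * x))"
    using fun_cong[OF \<gamma>] by (simp add: obj_def rate_def A_def K_def \<gamma>_def log_def mult_ac)
  have feas: "feasible = (\<lambda>x. \<tau> \<le> \<Lambda> * x \<and> 0 \<le> x \<and> x \<le> Pmax)"
    by (simp add: feasible_def \<gamma>)
  \<comment> \<open>Any feasible power lies between \<open>\<tau> / \<Lambda>\<close> and
    \<open>Pmax\<close>, so feasibility amounts to the interval being nonempty.\<close>
  obtain x where "\<tau> \<le> \<Lambda> * x" "x \<le> Pmax"
    using feasible by (auto simp: feas)
  then have "\<tau> / \<Lambda> \<le> x"
    using \<Lambda>_pos by (simp add: field_simps)
  then have nonempty: "\<tau> / \<Lambda> \<le> Pmax"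
    using \<open>x \<le> Pmax\<close> by simp
  have G: "G = K / A - 1 / \<Lambda>"
    by (simp add: G_def K_def A_def)
  have mu: "mu_opt = (if G < \<tau> / \<Lambda> then A / \<Lambda> - K / (\<tau> + 1) else 0)"
    by (simp add: mu_opt_def A_def K_def)
  have nu: "nu_opt = (if G \<le> Pmax then 0 else K / (Pmax + 1 / \<Lambda>) - A)"
    by (simp add: nu_opt_def A_def K_def)
  show ?thesis
    \<comment> \<open>Written in \<open>A\<close>, \<open>K\<close>, \<open>\<Lambda>\<close> and
      \<open>\<tau>\<close>, the two conjuncts are the two conclusions of
      \<open>water_filling\<close>.\<close>
    unfolding mu nu p_opt_def obj feas \<gamma> G
    using water_filling[OF A_pos K_pos \<Lambda>_pos \<tau>_pos consts_pos(2) nonempty] by blast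
qed

end
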